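(* Let $\mathcal{P}$ be a weakly compact family of probability measures on $\Omega=C([0,\infty);\mathbb{R}^k)$ with upper capacity $c$, let $Y$ be a $d$-dimensional continuous $\mathcal{P}$-semimartingale, let $Q\subset\mathbb{R}^d$ be open, and let $\tau_Q,\tau_{\overline Q}$ be the exit times of $Y$ from $Q$ and $\overline Q$. Assume that for any $\delta>0$ there exists an open set $O\subset\Omega$ with $c(O)\le\delta$ such that on $O^c$, $\tau_Q$ is lower semi-continuous, $\tau_{\overline Q}$ is upper semi-continuous, and $\tau_Q=\tau_{\overline Q}$. Then: (i) If $X$ is a quasi-continuous random variable, then $\tau_Q\wedge X$ and $\tau_{\overline Q}\wedge X$ are both quasi-continuous. (ii) If $X\in L^1_C(\Omega)$, then $\tau_Q\wedge X$ and $\tau_{\overline Q}\wedge X$ both belong to $L^1_C(\Omega)$.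
   Context: $\Omega=C([0,\infty);\mathbb{R}^k)$ carries the metric $\rho(\omega^1,\omega^2)=\sum_{N\ge1}2^{-N}[(\sup_{t\in[0,N]}|\omega^1_t-\omega^2_t|)\wedge1]$; $B_t(\omega)=\omega_t$, $\mathcal{F}_t=\sigma\{B_s:s\le t\}$. For a family $\mathcal{P}$ of probability measures on $(\Omega,\mathcal{B}(\Omega))$: $\hat{\mathbb{E}}[X]=\sup_{P\in\mathcal{P}}E_P[X]$ and $c(A)=\sup_{P\in\mathcal{P}}P(A)$. A property holds q.s. (quasi-surely) if it holds $P$-a.s. for every $P\in\mathcal{P}$; random variables that coincide q.s. are not distinguished. An $(\mathcal{F}_t)$-adapted process is a $\mathcal{P}$-semimartingale if it is a semimartingale under each $P\in\mathcal{P}$. For $D\subset\mathbb{R}^d$, $\tau_D(\omega)=\inf\{t\ge0:Y_t(\omega)\in D^c\}$ (with $\inf\emptyset=\infty$). A function $X:\Omega\to\mathbb{R}$ is quasi-continuous if for each $\varepsilon>0$ there is an open $O\subset\Omega$ with $c(O)<\varepsilon$ such that $X|_{O^c}$ is continuous. $L^1_C(\Omega)$ is the completion of $C_b(\Omega)$ (bounded continuous functions) under the norm $\|X\|_1=\hat{\mathbb{E}}[|X|]$, viewed as a subspace of the Banach space $L^1(\Omega)$ of (q.s. classes of) Borel $X$ with $\|X\|_1<\infty$. Semi-continuity of $[0,\infty]$-valued functions "on $O^c$" refers to the restriction to the metric space $O^c$, with upper (lower) semi-continuity meaning $\limsup_{x\to x_0}f(x)\le f(x_0)$ ($\liminf_{x\to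 x_0}f(x)\ge f(x_0)$) for each $x_0$. *)

theory Defs
  imports "HOL-Probability.Probability"
begin

section \<open>The path space\<close>

text \<open>
  Paths are functions on \<^typ>\<open>real\<close> that are only meaningful on \<open>[0, \<infinity>)\<close>; fixing the value
  outside \<open>{0..}\<close> (\<^const>\<open>extensional\<close>) makes equality of paths coincide with equality on
  \<open>[0, \<infinity>)\<close>.
\<close>

typedef (overloaded) ('a::real_normed_vector) path =
  "{w :: real \<Rightarrow> 'a. continuous_on {0..} w \<and> w \<in> extensional {0..}}"
  morphisms coord Abs_path
  by (rule exI[of _ "restrict (\<lambda>_. 0) {0..}"])
     (auto intro: continuous_on_eq[OF continuous_on_const])

lemma continuous_on_coord: "continuous_on {0..} (coord w)"
  using coord[of w] by simp

lemma path_eqI: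
  assumes "\<And>t. 0 \<le> t \<Longrightarrow> coord v t = coord w t"
  shows "v = w"
proof -
  have "coord v = coord w"
    using coord[of v] coord[of w] assms by (intro extensionalityI[of _ "{0..}"]) auto
  then show ?thesis by (simp add: coord_inject)
qed

definition sup_norm_upto :: "real \<Rightarrow> ('a::real_normed_vector) path \<Rightarrow> 'a path \<Rightarrow> real" where
  "sup_norm_upto T v w = (SUP t\<in>{0..T}. norm (coord v t - coord w t))"

lemma sup_norm_upto_bdd: "bdd_above ((\<lambda>t. norm (coord v t - coord w t)) ` {0..T})"
proof -
  have "continuous_on {0..T} (\<lambda>t. norm (coord v t - coord w t))"
    by (intro continuous_intros continuous_on_subset[OF continuous_on_coord]) auto
  then have "compact ((\<lambda>t. norm (coord v t - coord w t)) ` {0..T})"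
    by (rule compact_continuous_image) simp
  then show ?thesis
    by (intro bounded_imp_bdd_above compact_imp_bounded)
qed

lemma norm_le_sup_norm_upto:
  "0 \<le> t \<Longrightarrow> t \<le> T \<Longrightarrow> norm (coord v t - coord w t) \<le> sup_norm_upto T v w"
  unfolding sup_norm_upto_def by (rule cSUP_upper[OF _ sup_norm_upto_bdd]) auto

lemma sup_norm_upto_nonneg: "0 \<le> T \<Longrightarrow> 0 \<le> sup_norm_upto T v w"
  using norm_le_sup_norm_upto[of 0 T v w] norm_ge_zero order_trans by blast

lemma sup_norm_upto_triangle:
  assumes "0 \<le> T"
  shows "sup_norm_upto T u w \<le> sup_norm_upto T u v + sup_norm_upto T w v"
  unfolding sup_norm_upto_def[of T u w]
proof (rule cSUP_least)
  fix t assume t: "t \<in> {0..T}"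
  have "norm (coord u t - coord w t) \<le> norm (coord u t - coord v t) + norm (coord w t - coord v t)"
    using norm_triangle_ineq4[of "coord u t - coord v t" "coord w t - coord v t"] by simp
  also have "\<dots> \<le> sup_norm_upto T u v + sup_norm_upto T w v"
    using t by (intro add_mono norm_le_sup_norm_upto) auto
  finally show "norm (coord u t - coord w t) \<le> sup_norm_upto T u v + sup_norm_upto T w v" .
qed (use assms in auto)

instantiation path :: (real_normed_vector) metric_space
begin

text \<open>The summand with index \<open>n\<close> is the one for \<open>N = n + 1\<close>, so that the sum runs over \<open>N \<ge> 1\<close>.\<close>

definition dist_path :: "'a path \<Rightarrow> 'a path \<Rightarrow> real" where
  "dist_path v w = (\<Sum>n. (1/2) ^ Suc n * min (sup_norm_upto (real (Suc n)) v w) 1)"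

definition uniformity_path :: "('a path \<times> 'a path) filter" where
  "uniformity_path = (INF e\<in>{0<..}. principal {(v, w). dist v w < e})"

definition open_path :: "'a path set \<Rightarrow> bool" where
  "open_path U = (\<forall>v\<in>U. \<forall>\<^sub>F (v', w) in uniformity. v' = v \<longrightarrow> w \<in> U)"

instance
proof
  have summ: "summable (\<lambda>n. (1/2) ^ Suc n * min (sup_norm_upto (real (Suc n)) v w) 1)" for v w :: "'a path"
  proof (rule summable_comparison_test'[where N = 0 and g = "\<lambda>n. (1/2) ^ Suc n"])
    show "summable (\<lambda>n. (1/2::real) ^ Suc n)"
      by (simp add: summable_geometric_iff)
    show "norm ((1/2) ^ Suc n * min (sup_norm_upto (real (Suc n)) v w) 1) \<le> (1/2) ^ Suc n" for n
    proof -
      have "\<bar>min (sup_norm_upto (real (Suc n)) v w) 1\<bar> \<le> 1"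
        using sup_norm_upto_nonneg[of "real (Suc n)" v w] by auto
      then show ?thesis
        unfolding real_norm_def abs_mult by (intro mult_left_le[THEN order_trans]) auto
    qed
  qed
  have nn: "0 \<le> (1/2) ^ Suc n * min (sup_norm_upto (real (Suc n)) v w) 1" for n and v w :: "'a path"
    using sup_norm_upto_nonneg[of "real (Suc n)" v w] by auto
  fix u v w :: "'a path"
  show "dist v w = 0 \<longleftrightarrow> v = w"
  proof
    assume "dist v w = 0"
    then have z: "(1/2) ^ Suc n * min (sup_norm_upto (real (Suc n)) v w) 1 = 0" for n
      using suminf_eq_zero_iff[OF summ nn, of v w] unfolding dist_path_def by blast
    show "v = w"
    proof (rule path_eqI)
      fix t :: real assume t: "0 \<le> t"
      obtain n where n: "t \<le> real n" using real_arch_simple by blast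
      have "min (sup_norm_upto (real (Suc n)) v w) 1 = 0"
        using z[of n] by simp
      then have "sup_norm_upto (real (Suc n)) v w = 0"
        by (auto simp: min_def split: if_splits)
      then have "norm (coord v t - coord w t) \<le> 0"
        using norm_le_sup_norm_upto[of t "real (Suc n)" v w] t n by simp
      then show "coord v t = coord w t" by simp
    qed
  next
    assume "v = w"
    then have "sup_norm_upto (real (Suc n)) v w = 0" for n
      by (simp add: sup_norm_upto_def)
    then show "dist v w = 0" by (simp add: dist_path_def)
  qed
  show "dist u v \<le> dist u w + dist v w"
  proof -
    have "dist u v \<le> (\<Sum>n. (1/2) ^ Suc n * min (sup_norm_upto (real (Suc n)) u w) 1
        + (1/2) ^ Suc n * min (sup_norm_upto (real (Suc n)) v w) 1)"
      unfolding dist_path_def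
    proof (rule suminf_le[OF _ summ summable_add[OF summ summ]])
      fix n
      have "min (sup_norm_upto (real (Suc n)) u v) 1
        \<le> min (sup_norm_upto (real (Suc n)) u w) 1 + min (sup_norm_upto (real (Suc n)) v w) 1"
        using sup_norm_upto_triangle[of "real (Suc n)" u v w]
          sup_norm_upto_nonneg[of "real (Suc n)" u w] sup_norm_upto_nonneg[of "real (Suc n)" v w]
        by (auto simp: min_def)
      then show "(1/2) ^ Suc n * min (sup_norm_upto (real (Suc n)) u v) 1
        \<le> (1/2) ^ Suc n * min (sup_norm_upto (real (Suc n)) u w) 1
          + (1/2) ^ Suc n * min (sup_norm_upto (real (Suc n)) v w) 1"
        unfolding distrib_left[symmetric] by (intro mult_left_mono) auto
    qed
    also have "\<dots> = dist u w + dist v w"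
      unfolding dist_path_def by (rule suminf_add[OF summ summ, symmetric])
    finally show ?thesis .
  qed
qed (simp_all add: uniformity_path_def open_path_def)

end


section \<open>Weak compactness and upper expectation\<close>

definition borel_prob_measures :: "('a::topological_space) measure set" where
  "borel_prob_measures = {P. prob_space P \<and> sets P = sets borel}"

text \<open>The coarsest topology on the probability measures for which \<open>P \<mapsto> \<integral> f dP\<close> is continuous
  for every bounded continuous \<open>f\<close>.\<close>

definition weak_topology :: "('a::topological_space) measure topology" where
  "weak_topology = topology_generated_by
     {{P \<in> borel_prob_measures. (\<integral>x. f x \<partial>P) \<in> U} | (f :: 'a \<Rightarrow> real) U. f \<in> bcontfun \<and> open U}"

definition weakly_compact :: "('a::topological_space) measure set \<Rightarrow> bool" where
  "weakly_compact \<P> \<longleftrightarrow> compactin weak_topology \<P>"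

definition upper_capacity :: "'a measure set \<Rightarrow> 'a set \<Rightarrow> ennreal" where
  "upper_capacity \<P> A = (SUP P\<in>\<P>. emeasure P A)"

text \<open>Only integrands with values in \<open>[0, \<infinity>]\<close> are needed.\<close>

definition upper_expectation :: "'a measure set \<Rightarrow> ('a \<Rightarrow> ennreal) \<Rightarrow> ennreal" where
  "upper_expectation \<P> X = (SUP P\<in>\<P>. \<integral>\<^sup>+\<omega>. X \<omega> \<partial>P)"

definition upper_L1_norm :: "'a measure set \<Rightarrow> ('a \<Rightarrow> real) \<Rightarrow> ennreal" where
  "upper_L1_norm \<P> X = upper_expectation \<P> (\<lambda>\<omega>. ennreal \<bar>X \<omega>\<bar>)"

definition quasi_continuous :: "('a::topological_space) measure set \<Rightarrow> ('a \<Rightarrow> real) \<Rightarrow> bool" where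
  "quasi_continuous \<P> X \<longleftrightarrow>
     (\<forall>\<epsilon>>0. \<exists>U. open U \<and> upper_capacity \<P> U < ennreal \<epsilon> \<and> continuous_on (- U) X)"

definition upper_L1 :: "('a::topological_space) measure set \<Rightarrow> ('a \<Rightarrow> real) set" where
  "upper_L1 \<P> = {X \<in> borel_measurable borel. upper_L1_norm \<P> X < \<infinity>}"

text \<open>
  The completion of the bounded continuous functions, as a subspace of the Banach space of
  quasi-sure classes of \<^const>\<open>upper_L1\<close>, is their closure there. A class is represented by its
  Borel members: the set below contains with a function every Borel function that equals it
  quasi-surely.
\<close>

definition upper_L1C :: "('a::topological_space) measure set \<Rightarrow> ('a \<Rightarrow> real) set" where
  "upper_L1C \<P> = {X \<in> upper_L1 \<P>. \<exists>\<phi>. (\<forall>n. \<phi> n \<in> bcontfun) \<and>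
     (\<lambda>n. upper_L1_norm \<P> (\<lambda>\<omega>. X \<omega> - \<phi> n \<omega>)) \<longlonglongrightarrow> 0}"


section \<open>Semimartingales\<close>

text \<open>Processes have type \<open>real \<Rightarrow> 'a \<Rightarrow> 'b\<close>; only times \<open>t \<ge> 0\<close> matter.\<close>

definition canonical_filtration :: "real \<Rightarrow> (('a::real_normed_vector) path) measure" where
  "canonical_filtration t =
     sigma UNIV {(\<lambda>\<omega>. coord \<omega> s) -` A | s A. 0 \<le> s \<and> s \<le> t \<and> A \<in> sets borel}"

text \<open>\<open>\<F>\<^sup>P\<^sub>t = \<Inter>\<^sub>u\<^sub>>\<^sub>t \<sigma>(\<F>\<^sub>u \<union> \<N>)\<close>, where \<open>\<N>\<close> consists of all subsets of \<open>P\<close>-null sets.\<close>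

definition usual_augmentation :: "'a measure \<Rightarrow> (real \<Rightarrow> 'a measure) \<Rightarrow> real \<Rightarrow> 'a measure" where
  "usual_augmentation P F t =
     sigma (space P) (\<Inter>u\<in>{t<..}. sigma_sets (space P) (sets (F u) \<union> null_sets (completion P)))"

definition adapted :: "(real \<Rightarrow> 'a measure) \<Rightarrow> (real \<Rightarrow> 'a \<Rightarrow> 'b::topological_space) \<Rightarrow> bool" where
  "adapted F X \<longleftrightarrow> (\<forall>t\<ge>0. X t \<in> borel_measurable (F t))"

definition cadlag :: "(real \<Rightarrow> real) \<Rightarrow> bool" where
  "cadlag a \<longleftrightarrow> (\<forall>t\<ge>0. (a \<longlongrightarrow> a t) (at_right t)) \<and> (\<forall>t>0. \<exists>l. (a \<longlongrightarrow> l) (at_left t))"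

definition locally_finite_variation :: "(real \<Rightarrow> real) \<Rightarrow> bool" where
  "locally_finite_variation a \<longleftrightarrow>
     (\<forall>T\<ge>0. \<exists>C. \<forall>n p. mono_on {..n} p \<and> p ` {..n} \<subseteq> {0..T} \<longrightarrow>
        (\<Sum>i<n::nat. \<bar>a (p (Suc i)) - a (p i)\<bar>) \<le> C)"

text \<open>Unlike in \<^const>\<open>stopping_time\<close>, the value \<open>\<infinity>\<close> is allowed.\<close>

definition ext_stopping_time :: "(real \<Rightarrow> 'a measure) \<Rightarrow> ('a \<Rightarrow> ereal) \<Rightarrow> bool" where
  "ext_stopping_time F T \<longleftrightarrow>
     (\<forall>\<omega>. 0 \<le> T \<omega>) \<and> (\<forall>t\<ge>0. {\<omega> \<in> space (F t). T \<omega> \<le> ereal t} \<in> sets (F t))"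

definition stopped :: "(real \<Rightarrow> 'a \<Rightarrow> real) \<Rightarrow> ('a \<Rightarrow> ereal) \<Rightarrow> real \<Rightarrow> 'a \<Rightarrow> real" where
  "stopped X T t \<omega> = X (real_of_ereal (min (ereal t) (T \<omega>))) \<omega>"

definition martingale :: "'a measure \<Rightarrow> (real \<Rightarrow> 'a measure) \<Rightarrow> (real \<Rightarrow> 'a \<Rightarrow> real) \<Rightarrow> bool" where
  "martingale M F X \<longleftrightarrow> adapted F X \<and> (\<forall>t\<ge>0. integrable M (X t)) \<and>
     (\<forall>s\<ge>0. \<forall>t\<ge>s. AE \<omega> in M. real_cond_exp M (F s) (X t) \<omega> = X s \<omega>)"

definition local_martingale :: "'a measure \<Rightarrow> (real \<Rightarrow> 'a measure) \<Rightarrow> (real \<Rightarrow> 'a \<Rightarrow> real) \<Rightarrow> bool" where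
  "local_martingale M F X \<longleftrightarrow> adapted F X \<and> (\<forall>\<omega>\<in>space M. cadlag (\<lambda>t. X t \<omega>)) \<and>
     (\<exists>T :: nat \<Rightarrow> 'a \<Rightarrow> ereal. (\<forall>n. ext_stopping_time F (T n)) \<and>
        (\<forall>\<omega>\<in>space M. incseq (\<lambda>n. T n \<omega>)) \<and> (AE \<omega> in M. (\<lambda>n. T n \<omega>) \<longlonglongrightarrow> \<infinity>) \<and>
        (\<forall>n. martingale M F (\<lambda>t \<omega>. stopped X (T n) t \<omega> - X 0 \<omega>)))"

text \<open>
  \<open>X = X\<^sub>0 + N + A\<close> up to indistinguishability. As usual, the decomposition is understood with
  respect to a filtration that satisfies the usual conditions, namely the usual augmentation of
  \<open>F\<close> under \<open>P\<close>, on the completed probability space.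
\<close>

definition semimartingale :: "'a measure \<Rightarrow> (real \<Rightarrow> 'a measure) \<Rightarrow> (real \<Rightarrow> 'a \<Rightarrow> real) \<Rightarrow> bool" where
  "semimartingale P F X \<longleftrightarrow> adapted F X \<and>
     (\<exists>N A. local_martingale (completion P) (usual_augmentation P F) N \<and>
        adapted (usual_augmentation P F) A \<and>
        (\<forall>\<omega>\<in>space P. cadlag (\<lambda>t. A t \<omega>) \<and> locally_finite_variation (\<lambda>t. A t \<omega>)) \<and>
        (\<forall>\<omega>\<in>space P. N 0 \<omega> = 0 \<and> A 0 \<omega> = 0) \<and>
        (AE \<omega> in P. \<forall>t\<ge>0. X t \<omega> = X 0 \<omega> + N t \<omega> + A t \<omega>))"

definition continuous_semimartingale_family ::
  "(('a::real_normed_vector) path) measure set \<Rightarrow> (real \<Rightarrow> 'a path \<Rightarrow> real ^ 'd) \<Rightarrow> bool" where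
  "continuous_semimartingale_family \<P> Y \<longleftrightarrow>
     adapted canonical_filtration Y \<and> (\<forall>\<omega>. continuous_on {0..} (\<lambda>t. Y t \<omega>)) \<and>
     (\<forall>P\<in>\<P>. \<forall>i. semimartingale P canonical_filtration (\<lambda>t \<omega>. Y t \<omega> $ i))"


section \<open>Exit times and semicontinuity\<close>

definition exit_time :: "(real \<Rightarrow> 'a \<Rightarrow> 'b) \<Rightarrow> 'b set \<Rightarrow> 'a \<Rightarrow> ereal" where
  "exit_time Y D \<omega> = Inf (ereal ` {t. 0 \<le> t \<and> Y t \<omega> \<in> - D})"

text \<open>\<open>\<tau> \<and> X\<close> for a \<open>[0, \<infinity>]\<close>-valued \<open>\<tau>\<close> and a real-valued \<open>X\<close>; the minimum is always finite.\<close>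

definition min_rv :: "('a \<Rightarrow> ereal) \<Rightarrow> ('a \<Rightarrow> real) \<Rightarrow> 'a \<Rightarrow> real" where
  "min_rv \<tau> X \<omega> = real_of_ereal (min (\<tau> \<omega>) (ereal (X \<omega>)))"

text \<open>
  At an isolated point of \<open>S\<close> the filter is trivial and both conditions hold, since then
  \<open>Limsup\<close> is \<open>-\<infinity>\<close> and \<open>Liminf\<close> is \<open>\<infinity>\<close>.
\<close>

definition upper_semicontinuous_on :: "('a::topological_space) set \<Rightarrow> ('a \<Rightarrow> ereal) \<Rightarrow> bool" where
  "upper_semicontinuous_on S f \<longleftrightarrow> (\<forall>x\<in>S. Limsup (at x within S) f \<le> f x)"

definition lower_semicontinuous_on :: "('a::topological_space) set \<Rightarrow> ('a \<Rightarrow> ereal) \<Rightarrow> bool" where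
  "lower_semicontinuous_on S f \<longleftrightarrow> (\<forall>x\<in>S. f x \<le> Liminf (at x within S) f)"

end

theory Submission
  imports Defs
begin

text \<open>
  Off a set of small capacity the two exit times coincide and are continuous, so truncating them by
  a quasi-continuous \<open>X\<close> gives a quasi-continuous function. For the second part, a bounded
  quasi-continuous Borel function is a limit of bounded continuous ones by Tietze's
  theorem. This covers \<open>\<tau> \<and> \<phi>\<close> for \<open>\<phi> \<in> C\<^sub>b\<close>, and \<open>X \<mapsto> \<tau> \<and> X\<close> is a contraction for the
  \<open>L\<^sup>1\<close>-norm.
\<close>

section \<open>Measurability of exit times\<close>

lemma scaled_sup_norm_upto_le_dist:
  fixes v w :: "('a::real_normed_vector) path"
  shows "(1/2) ^ Suc n * min (sup_norm_upto (real (Suc n)) v w) 1 \<le> dist v w"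
proof -
  let ?f = "\<lambda>n. (1/2) ^ Suc n * min (sup_norm_upto (real (Suc n)) v w) 1"
  have nn: "0 \<le> ?f n" for n
    using sup_norm_upto_nonneg[of "real (Suc n)" v w] by auto
  have le: "?f n \<le> (1/2) ^ Suc n" for n
    by (intro mult_left_le) auto
  have summ: "summable ?f"
  proof (rule summable_comparison_test'[where N = 0 and g = "\<lambda>n. (1/2) ^ Suc n"])
    show "summable (\<lambda>n. (1/2::real) ^ Suc n)"
      by (simp add: summable_geometric_iff)
    show "norm (?f n) \<le> (1/2) ^ Suc n" for n
      using nn[of n] le[of n] by simp
  qed
  have "sum ?f {n} \<le> suminf ?f"
    by (intro sum_le_suminf summ) (use nn in auto)
  then show ?thesis
    by (simp add: dist_path_def)
qed

text \<open>One summand of the path metric already controls the distance of two paths uniformly on a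
  compact interval containing \<open>s\<close>.\<close>

lemma continuous_on_coord_at:
  assumes "0 \<le> s"
  shows "continuous_on UNIV (\<lambda>\<omega> :: ('a::real_normed_vector) path. coord \<omega> s)"
  unfolding continuous_on_iff
proof (intro ballI allI impI)
  fix v :: "'a path" and e :: real
  assume e: "0 < e"
  obtain n where n: "s \<le> real n" using real_arch_simple by blast
  show "\<exists>d>0. \<forall>w\<in>UNIV. dist w v < d \<longrightarrow> dist (coord w s) (coord v s) < e"
  \<comment> \<open>The weight of the summand for \<open>[0, n + 1]\<close>, times \<open>e\<close>
    capped at 1 because the metric caps sup norms at 1. A capped sup norm below
    \<open>min e 1\<close> forces the sup norm itself below \<open>e\<close>.\<close>
  proof (intro exI[of _ "(1/2) ^ Suc n * min e 1"] conjI ballI impI)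
    show "0 < (1/2) ^ Suc n * min e 1" using e by simp
    fix w assume "dist w v < (1/2) ^ Suc n * min e 1"
    then have "(1/2) ^ Suc n * min (sup_norm_upto (real (Suc n)) w v) 1 < (1/2) ^ Suc n * min e 1"
      using scaled_sup_norm_upto_le_dist[of n w v] by linarith
    then have "min (sup_norm_upto (real (Suc n)) w v) 1 < min e 1"
      by (subst (asm) mult_less_cancel_left_pos) auto
    moreover have "norm (coord w s - coord v s) \<le> sup_norm_upto (real (Suc n)) w v"
      using assms n by (intro norm_le_sup_norm_upto) auto
    ultimately show "dist (coord w s) (coord v s) < e"
      unfolding dist_norm by (auto simp: min_def split: if_splits)
  qed
qed

text \<open>The generators are preimages of Borel sets under evaluations, which are continuous. This
  ties the filtration to the Borel sets of the path metric, on which the measures are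
  defined.\<close>

lemma sets_canonical_filtration_subset:
  "sets (canonical_filtration t :: ('a::real_normed_vector) path measure) \<subseteq> sets borel"
proof -
  let ?G = "{(\<lambda>\<omega> :: 'a path. coord \<omega> s) -` A | s A. 0 \<le> s \<and> s \<le> t \<and> A \<in> sets borel}"
  have "?G \<subseteq> sets borel"
  proof clarify
    fix s :: real and A :: "'a set" assume "0 \<le> s" "A \<in> sets borel"
    then show "(\<lambda>\<omega> :: 'a path. coord \<omega> s) -` A \<in> sets borel"
      using measurable_sets[OF borel_measurable_continuous_onI[OF continuous_on_coord_at], of s A]
      by simp
  qed
  then have "sigma_sets UNIV ?G \<subseteq> sets borel"
    using sets.sigma_sets_subset[of ?G borel] by simp
  then show ?thesis
    by (simp add: canonical_filtration_def)
qed

lemma adapted_canonical_borel_measurable: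
  assumes "adapted canonical_filtration Y" "0 \<le> t"
  shows "Y t \<in> borel_measurable borel"
proof -
  have "Y t \<in> borel_measurable (canonical_filtration t)"
    using assms by (simp add: adapted_def)
  also have "\<dots> \<subseteq> borel_measurable borel"
    by (intro measurable_mono sets_canonical_filtration_subset)
       (simp_all add: canonical_filtration_def)
  finally show ?thesis .
qed

section \<open>Exit times as infima, and their measurability\<close>

lemma exit_time_nonneg: "0 \<le> exit_time Y D \<omega>"
  unfolding exit_time_def by (rule Inf_greatest) auto

text \<open>A strict bound yields a witness time although the infimum need not be attained, for
  instance when \<open>D\<close> is closed.\<close>

lemma exit_time_less_iff: "exit_time Y D \<omega> < y \<longleftrightarrow> (\<exists>t\<ge>0. Y t \<omega> \<notin> D \<and> ereal t < y)"
  unfolding exit_time_def Inf_less_iff by auto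

lemma exit_time_mono: "D \<subseteq> E \<Longrightarrow> exit_time Y D \<omega> \<le> exit_time Y E \<omega>"
  unfolding exit_time_def by (rule Inf_superset_mono) auto

text \<open>A continuous path enters the open set \<open>- D\<close> before \<open>y\<close> iff it is there at a rational time
  before \<open>y\<close>.\<close>

lemma borel_measurable_exit_time_closed:
  fixes Y :: "real \<Rightarrow> 'a \<Rightarrow> 'b::topological_space"
  assumes meas: "\<And>t. 0 \<le> t \<Longrightarrow> Y t \<in> borel_measurable M"
    and cont: "\<And>\<omega>. continuous_on {0..} (\<lambda>t. Y t \<omega>)"
    and D: "closed D"
  shows "exit_time Y D \<in> borel_measurable M"
proof (rule borel_measurableI_less)
  fix y :: ereal
  define A where "A = {q \<in> \<rat>. 0 \<le> q \<and> ereal q < y}"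
  have "countable A"
    using countable_subset[OF _ countable_rat, of A] by (auto simp: A_def)
  have iff: "exit_time Y D \<omega> < y \<longleftrightarrow> (\<exists>q\<in>A. Y q \<omega> \<notin> D)" for \<omega>
  proof
    assume "exit_time Y D \<omega> < y"
    then obtain t where t: "0 \<le> t" "Y t \<omega> \<notin> D" "ereal t < y"
      unfolding exit_time_less_iff by blast
    \<comment> \<open>Since \<open>t\<close> may be 0, only a right neighbourhood of
      \<open>t\<close> is available; openness of \<open>- D\<close> keeps the path outside
      \<open>D\<close> there.\<close>
    have "continuous_on {t..} (\<lambda>t. Y t \<omega>)"
      using cont by (rule continuous_on_subset) (use t in auto)
    then have "((\<lambda>s. Y s \<omega>) \<longlongrightarrow> Y t \<omega>) (at_right t)"
      unfolding continuous_on_def at_within_Ici_at_right[symmetric] by simp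
    then have "\<forall>\<^sub>F s in at_right t. Y s \<omega> \<in> - D"
      using D t by (auto dest!: topological_tendstoD[of _ _ _ "- D"])
    then obtain b where b: "t < b" "\<And>s. t < s \<Longrightarrow> s < b \<Longrightarrow> Y s \<omega> \<notin> D"
      unfolding eventually_at_right_field by auto
    \<comment> \<open>A real \<open>c\<close> is inserted because \<open>y\<close> may be
      \<open>\<infinity>\<close>; a rational below both \<open>b\<close> and \<open>c\<close> still
      lies before \<open>y\<close>.\<close>
    obtain c where c: "t < c" "ereal c < y"
      using ereal_dense2[OF t(3)] by auto
    obtain q where q: "q \<in> \<rat>" "t < q" "q < min b c"
      using Rats_dense_in_real[of t "min b c"] b c by auto
    have "ereal q < y"
      using q c less_trans[of "ereal q" "ereal c" y] by simp
    then show "\<exists>q\<in>A. Y q \<omega> \<notin> D"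
      using q t b by (intro bexI[of _ q]) (auto simp: A_def)
  qed (auto simp: exit_time_less_iff A_def)
  have "{\<omega> \<in> space M. Y q \<omega> \<notin> D} \<in> sets M" if "q \<in> A" for q
  proof -
    have "Y q -` (- D) \<inter> space M \<in> sets M"
      using that D by (intro measurable_sets[OF meas]) (auto simp: A_def)
    moreover have "Y q -` (- D) \<inter> space M = {\<omega> \<in> space M. Y q \<omega> \<notin> D}" by auto
    ultimately show ?thesis by simp
  qed
  then have "(\<Union>q\<in>A. {\<omega> \<in> space M. Y q \<omega> \<notin> D}) \<in> sets M"
    using \<open>countable A\<close> by (intro sets.countable_UN') auto
  also have "(\<Union>q\<in>A. {\<omega> \<in> space M. Y q \<omega> \<notin> D}) = {\<omega> \<in> space M. exit_time Y D \<omega> < y}"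
    by (auto simp: iff)
  finally show "{\<omega> \<in> space M. exit_time Y D \<omega> < y} \<in> sets M" .
qed

text \<open>The exit time from an open set is the supremum of the exit times from the closed sets of
  points at distance at least \<open>1 / (n + 1)\<close> from the complement.\<close>

lemma borel_measurable_exit_time_open:
  fixes Y :: "real \<Rightarrow> 'a \<Rightarrow> 'b::heine_borel"
  assumes meas: "\<And>t. 0 \<le> t \<Longrightarrow> Y t \<in> borel_measurable M"
    and cont: "\<And>\<omega>. continuous_on {0..} (\<lambda>t. Y t \<omega>)"
    and D: "open D"
  shows "exit_time Y D \<in> borel_measurable M"
proof (rule borel_measurableI_greater)
  fix y :: ereal
  define E where "E n = {x. \<forall>z\<in>- D. inverse (real (Suc n)) \<le> dist x z}" for n
  have "E n = (\<Inter>z\<in>- D. {x. inverse (real (Suc n)) \<le> dist x z})" for n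
    by (auto simp: E_def)
  then have "closed (E n)" for n
    by (simp only:) (intro closed_INT ballI closed_Collect_le continuous_intros)
  note E = borel_measurable_exit_time_closed[OF meas cont this]
  have ED: "E n \<subseteq> D" for n
  proof
    fix x assume "x \<in> E n"
    then show "x \<in> D"
      by (cases "x \<in> D") (auto simp: E_def dest!: bspec[of _ _ x])
  qed
  have iff: "y < exit_time Y D \<omega> \<longleftrightarrow> (\<exists>n. y < exit_time Y (E n) \<omega>)" for \<omega>
  proof
    assume "y < exit_time Y D \<omega>"
    \<comment> \<open>The real level in between leaves room on both sides: the path stays in
      \<open>D\<close> on all of \<open>[0, r]\<close>, and an exit time of at least
      \<open>r\<close> is strictly above \<open>y\<close>. For negative \<open>r\<close> the
      interval is empty and the argument still applies.\<close>
    then obtain r where r: "y < ereal r" "ereal r < exit_time Y D \<omega>"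
      using ereal_dense2 by blast
    let ?K = "(\<lambda>t. Y t \<omega>) ` {0..r}"
    have "compact ?K"
      by (intro compact_continuous_image continuous_on_subset[OF cont]) auto
    moreover have "?K \<inter> - D = {}"
    proof -
      have "Y t \<omega> \<in> D" if "0 \<le> t" "t \<le> r" for t
        using exit_time_less_iff[of Y D \<omega> "exit_time Y D \<omega>"] that r(2)
          le_less_trans[of "ereal t" "ereal r" "exit_time Y D \<omega>"] by auto
      then show ?thesis by auto
    qed
    \<comment> \<open>Compactness of the path segment yields a positive gap to the closed set
      \<open>- D\<close>; a threshold below \<open>d\<close> then puts the whole segment into
      \<open>E n\<close>.\<close>
    ultimately obtain d where d: "0 < d" "\<And>x z. x \<in> ?K \<Longrightarrow> z \<in> - D \<Longrightarrow> d \<le> dist x z"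
      using separate_compact_closed[of ?K "- D"] D unfolding closed_def double_complement by metis
    obtain n where n: "inverse (real (Suc n)) < d"
      using reals_Archimedean[OF d(1)] by blast
    have "Y t \<omega> \<in> E n" if "0 \<le> t" "t \<le> r" for t
      unfolding E_def using d(2)[of "Y t \<omega>"] n that by force
    then have "\<not> exit_time Y (E n) \<omega> < ereal r"
      unfolding exit_time_less_iff by auto
    then show "\<exists>n. y < exit_time Y (E n) \<omega>"
      using r(1) by (meson less_le_trans not_le)
  next
    assume "\<exists>n. y < exit_time Y (E n) \<omega>"
    then show "y < exit_time Y D \<omega>"
      using exit_time_mono[OF ED] less_le_trans by metis
  qed
  have "(\<Union>n. {\<omega> \<in> space M. y < exit_time Y (E n) \<omega>}) \<in> sets M"
    using E by (intro sets.countable_UN) (auto simp: borel_measurable_iff_greater)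
  also have "(\<Union>n. {\<omega> \<in> space M. y < exit_time Y (E n) \<omega>}) = {\<omega> \<in> space M. y < exit_time Y D \<omega>}"
    by (auto simp: iff)
  finally show "{\<omega> \<in> space M. y < exit_time Y D \<omega>} \<in> sets M" .
qed


section \<open>Truncation by a random variable\<close>

text \<open>For nonnegative \<open>\<tau>\<close> truncation changes only positive values of
  \<open>X\<close>, and these stay between 0 and \<open>X\<close>.\<close>

lemma abs_min_rv_le: "0 \<le> \<tau> \<omega> \<Longrightarrow> \<bar>min_rv \<tau> X \<omega>\<bar> \<le> \<bar>X \<omega>\<bar>"
  by (cases "\<tau> \<omega>") (auto simp: min_rv_def min_def)

text \<open>The minimum with a fixed level is 1-Lipschitz. This is the pointwise source of the
  contraction property in \<open>upper_L1_norm\<close>.\<close>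

lemma abs_min_rv_diff_le: "0 \<le> \<tau> \<omega> \<Longrightarrow> \<bar>min_rv \<tau> X \<omega> - min_rv \<tau> Z \<omega>\<bar> \<le> \<bar>X \<omega> - Z \<omega>\<bar>"
  by (cases "\<tau> \<omega>") (auto simp: min_rv_def min_def)

lemma borel_measurable_min_rv:
  assumes [measurable]: "\<tau> \<in> borel_measurable M" "X \<in> borel_measurable M"
  shows "min_rv \<tau> X \<in> borel_measurable M"
  unfolding min_rv_def by measurable

lemma continuous_on_min_rv:
  assumes "continuous_on S \<tau>" "continuous_on S X" "\<And>\<omega>. 0 \<le> \<tau> \<omega>"
  shows "continuous_on S (min_rv \<tau> X)"
proof -
  \<comment> \<open>\<open>real_of_ereal\<close> is continuous at finite values only. Nonnegativity
    of \<open>\<tau>\<close> excludes minus infinity, and the real value \<open>X \<omega>\<close>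
    excludes plus infinity.\<close>
  have fin: "min (\<tau> \<omega>) (ereal (X \<omega>)) \<in> UNIV - {\<infinity>, - \<infinity>}" for \<omega>
    using assms(3)[of \<omega>] by (cases "\<tau> \<omega>") (auto simp: min_def)
  have "continuous_on S (\<lambda>\<omega>. min (\<tau> \<omega>) (ereal (X \<omega>)))"
    using assms by (intro continuous_on_min continuous_on_ereal)
  then have "continuous_on S (real_of_ereal \<circ> (\<lambda>\<omega>. min (\<tau> \<omega>) (ereal (X \<omega>))))"
    using fin by (intro continuous_on_compose continuous_on_subset[OF continuous_on_real]) auto
  then show ?thesis
    by (simp add: min_rv_def[abs_def] comp_def)
qed

text \<open>In the order topology of \<open>ereal\<close>, convergence to \<open>f x\<close> means
  being eventually above every smaller value and eventually below every larger one; the two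
  semicontinuities are these two halves.\<close>

lemma continuous_on_iff_semicontinuous_on:
  "continuous_on S f \<longleftrightarrow> lower_semicontinuous_on S f \<and> upper_semicontinuous_on S f"
  unfolding continuous_on_def lower_semicontinuous_on_def upper_semicontinuous_on_def
    le_Liminf_iff Limsup_le_iff order_tendsto_iff by blast

text \<open>The filter \<open>at x within S\<close> sees only points of \<open>S\<close>. This
  carries upper semicontinuity from the exit time of the closure over to that of
  \<open>Q\<close>.\<close>

lemma upper_semicontinuous_on_cong:
  assumes "\<And>x. x \<in> S \<Longrightarrow> f x = g x" "upper_semicontinuous_on S f"
  shows "upper_semicontinuous_on S g"
proof -
  have "Limsup (at x within S) f = Limsup (at x within S) g" for x
    by (rule Limsup_eq) (auto simp: eventually_at_filter assms(1))
  then show ?thesis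
    using assms by (simp add: upper_semicontinuous_on_def)
qed


section \<open>Upper capacity and upper expectation\<close>

text \<open>Every generating set of \<open>weak_topology\<close> consists of Borel probability
  measures, hence so does the topspace, which contains each compact set.\<close>

lemma weakly_compact_subset_borel_prob_measures:
  assumes "weakly_compact \<P>"
  shows "\<P> \<subseteq> borel_prob_measures"
proof -
  have "\<P> \<subseteq> topspace weak_topology"
    using assms by (simp add: weakly_compact_def compactin_subset_topspace)
  also have "\<dots> \<subseteq> borel_prob_measures"
    unfolding weak_topology_def topology_generated_by_topspace by blast
  finally show ?thesis .
qed

lemma upper_capacity_Un_le:
  assumes "\<And>P. P \<in> \<P> \<Longrightarrow> A \<in> sets P" "\<And>P. P \<in> \<P> \<Longrightarrow> B \<in> sets P"
  shows "upper_capacity \<P> (A \<union> B) \<le> upper_capacity \<P> A + upper_capacity \<P> B"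
  unfolding upper_capacity_def
proof (rule SUP_least)
  fix P assume P: "P \<in> \<P>"
  have "emeasure P (A \<union> B) \<le> emeasure P A + emeasure P B"
    using assms P by (intro emeasure_subadditive) auto
  also have "\<dots> \<le> (SUP P\<in>\<P>. emeasure P A) + (SUP P\<in>\<P>. emeasure P B)"
    using P by (intro add_mono SUP_upper)
  finally show "emeasure P (A \<union> B) \<le> \<dots>" .
qed

section \<open>Norm estimates for the upper expectation\<close>

lemma upper_L1_norm_mono:
  assumes "\<And>\<omega>. \<bar>X \<omega>\<bar> \<le> \<bar>Z \<omega>\<bar>"
  shows "upper_L1_norm \<P> X \<le> upper_L1_norm \<P> Z"
  unfolding upper_L1_norm_def upper_expectation_def
  using assms by (intro SUP_mono' nn_integral_mono ennreal_leI) auto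

lemma upper_L1_norm_add_le:
  assumes "\<And>P. P \<in> \<P> \<Longrightarrow> X \<in> borel_measurable P" "\<And>P. P \<in> \<P> \<Longrightarrow> Z \<in> borel_measurable P"
  shows "upper_L1_norm \<P> (\<lambda>\<omega>. X \<omega> + Z \<omega>) \<le> upper_L1_norm \<P> X + upper_L1_norm \<P> Z"
  unfolding upper_L1_norm_def upper_expectation_def
proof (rule SUP_least)
  fix P assume P: "P \<in> \<P>"
  note [measurable] = assms[OF P]
  have "(\<integral>\<^sup>+\<omega>. ennreal \<bar>X \<omega> + Z \<omega>\<bar> \<partial>P) \<le> (\<integral>\<^sup>+\<omega>. ennreal \<bar>X \<omega>\<bar> + ennreal \<bar>Z \<omega>\<bar> \<partial>P)"
    by (intro nn_integral_mono) (simp flip: ennreal_plus)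
  also have "\<dots> = (\<integral>\<^sup>+\<omega>. ennreal \<bar>X \<omega>\<bar> \<partial>P) + (\<integral>\<^sup>+\<omega>. ennreal \<bar>Z \<omega>\<bar> \<partial>P)"
    by (rule nn_integral_add) auto
  also have "\<dots> \<le> (SUP P\<in>\<P>. \<integral>\<^sup>+\<omega>. ennreal \<bar>X \<omega>\<bar> \<partial>P) + (SUP P\<in>\<P>. \<integral>\<^sup>+\<omega>. ennreal \<bar>Z \<omega>\<bar> \<partial>P)"
    using P by (intro add_mono SUP_upper)
  finally show "(\<integral>\<^sup>+\<omega>. ennreal \<bar>X \<omega> + Z \<omega>\<bar> \<partial>P) \<le> \<dots>" .
qed

text \<open>Turns small capacity into a small norm; meant for the error of an approximation that is
  exact off \<open>A\<close>.\<close>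

lemma upper_L1_norm_le_upper_capacity:
  assumes "\<And>P. P \<in> \<P> \<Longrightarrow> A \<in> sets P" "0 \<le> K" "\<And>\<omega>. \<bar>X \<omega>\<bar> \<le> K * indicator A \<omega>"
  shows "upper_L1_norm \<P> X \<le> ennreal K * upper_capacity \<P> A"
  unfolding upper_L1_norm_def upper_expectation_def
proof (rule SUP_least)
  fix P assume P: "P \<in> \<P>"
  have "(\<integral>\<^sup>+\<omega>. ennreal \<bar>X \<omega>\<bar> \<partial>P) \<le> (\<integral>\<^sup>+\<omega>. ennreal K * indicator A \<omega> \<partial>P)"
  proof (rule nn_integral_mono)
    fix \<omega>
    have "ennreal \<bar>X \<omega>\<bar> \<le> ennreal (K * indicator A \<omega>)"
      using assms(3) by (rule ennreal_leI)
    also have "\<dots> = ennreal K * indicator A \<omega>"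
      by (auto simp: indicator_def)
    finally show "ennreal \<bar>X \<omega>\<bar> \<le> ennreal K * indicator A \<omega>" .
  qed
  also have "\<dots> = ennreal K * emeasure P A"
    using assms(1)[OF P] by (rule nn_integral_cmult_indicator)
  also have "\<dots> \<le> ennreal K * upper_capacity \<P> A"
    unfolding upper_capacity_def using P by (intro mult_left_mono SUP_upper) auto
  finally show "(\<integral>\<^sup>+\<omega>. ennreal \<bar>X \<omega>\<bar> \<partial>P) \<le> ennreal K * upper_capacity \<P> A" .
qed

section \<open>The space \<open>upper_L1\<close> and the closure \<open>upper_L1C\<close> of the
  bounded continuous functions\<close>

lemma upper_L1_mono:
  assumes "Z \<in> upper_L1 \<P>" "X \<in> borel_measurable borel" "\<And>\<omega>. \<bar>X \<omega>\<bar> \<le> \<bar>Z \<omega>\<bar>"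
  shows "X \<in> upper_L1 \<P>"
  using assms upper_L1_norm_mono[of X Z \<P>] by (auto simp: upper_L1_def intro: le_less_trans)

lemma bounded_in_upper_L1:
  assumes "\<P> \<subseteq> borel_prob_measures" "X \<in> borel_measurable borel" "\<And>\<omega>. \<bar>X \<omega>\<bar> \<le> K"
  shows "X \<in> upper_L1 \<P>"
proof -
  \<comment> \<open>Any point shows that the bound is nonnegative; \<open>undefined\<close> serves
    as one.\<close>
  have K: "0 \<le> K" using assms(3)[of undefined] by linarith
  have "upper_L1_norm \<P> X \<le> ennreal K * upper_capacity \<P> UNIV"
    using assms K by (intro upper_L1_norm_le_upper_capacity) (auto simp: borel_prob_measures_def)
  \<comment> \<open>An inequality rather than an equality, since the supremum over an empty family
    is 0.\<close>
  also have "\<dots> \<le> ennreal K * 1"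
    unfolding upper_capacity_def using assms(1)
    by (intro mult_left_mono SUP_least subprob_space.subprob_emeasure_le_1)
       (auto simp: borel_prob_measures_def intro: prob_space_imp_subprob_space)
  also have "\<dots> < \<infinity>" by simp
  finally show ?thesis
    using assms(2) by (simp add: upper_L1_def)
qed

text \<open>Trades the approximating sequence for one approximant per tolerance; conversely, the
  tolerances \<open>1 / (n + 1)\<close> give back a sequence.\<close>

lemma upper_L1C_iff:
  "X \<in> upper_L1C \<P> \<longleftrightarrow> X \<in> upper_L1 \<P> \<and>
     (\<forall>\<epsilon>>0. \<exists>\<phi>\<in>bcontfun. upper_L1_norm \<P> (\<lambda>\<omega>. X \<omega> - \<phi> \<omega>) < ennreal \<epsilon>)"
proof safe
  assume "X \<in> upper_L1C \<P>"
  then obtain \<phi> where \<phi>: "X \<in> upper_L1 \<P>" "\<And>n. \<phi> n \<in> bcontfun"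
    "(\<lambda>n. upper_L1_norm \<P> (\<lambda>\<omega>. X \<omega> - \<phi> n \<omega>)) \<longlonglongrightarrow> 0"
    by (auto simp: upper_L1C_def)
  then show "X \<in> upper_L1 \<P>" by simp
  fix \<epsilon> :: real assume "\<epsilon> > 0"
  then have "\<forall>\<^sub>F n in sequentially. upper_L1_norm \<P> (\<lambda>\<omega>. X \<omega> - \<phi> n \<omega>) < ennreal \<epsilon>"
    using \<phi>(3) by (intro order_tendstoD(2)) auto
  then show "\<exists>\<phi>\<in>bcontfun. upper_L1_norm \<P> (\<lambda>\<omega>. X \<omega> - \<phi> \<omega>) < ennreal \<epsilon>"
    using \<phi>(2) by (auto simp: eventually_sequentially)
next
  assume X: "X \<in> upper_L1 \<P>"
    and "\<forall>\<epsilon>>0. \<exists>\<phi>\<in>bcontfun. upper_L1_norm \<P> (\<lambda>\<omega>. X \<omega> - \<phi> \<omega>) < ennreal \<epsilon>"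
  then have "\<forall>n. \<exists>\<phi>\<in>bcontfun. upper_L1_norm \<P> (\<lambda>\<omega>. X \<omega> - \<phi> \<omega>) < ennreal (inverse (real (Suc n)))"
    by simp
  then obtain \<phi> where \<phi>: "\<And>n. \<phi> n \<in> bcontfun"
    "\<And>n. upper_L1_norm \<P> (\<lambda>\<omega>. X \<omega> - \<phi> n \<omega>) < ennreal (inverse (real (Suc n)))"
    by metis
  have "(\<lambda>n. ennreal (inverse (real (Suc n)))) \<longlonglongrightarrow> ennreal 0"
    by (intro tendsto_ennrealI LIMSEQ_inverse_real_of_nat)
  then have lim: "(\<lambda>n. ennreal (inverse (real (Suc n)))) \<longlonglongrightarrow> 0"
    by (simp only: ennreal_0)
  have "(\<lambda>n. upper_L1_norm \<P> (\<lambda>\<omega>. X \<omega> - \<phi> n \<omega>)) \<longlonglongrightarrow> 0"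
  proof (rule tendsto_sandwich[OF _ _ tendsto_const lim])
    show "\<forall>\<^sub>F n in sequentially.
        upper_L1_norm \<P> (\<lambda>\<omega>. X \<omega> - \<phi> n \<omega>) \<le> ennreal (inverse (real (Suc n)))"
      using \<phi>(2) by (intro always_eventually allI less_imp_le)
  qed simp
  then show "X \<in> upper_L1C \<P>"
    using X \<phi>(1) by (auto simp: upper_L1C_def)
qed

text \<open>Continuity on the closed set \<open>- U\<close> gives a Tietze extension with the same
  bound \<open>K\<close>. The error vanishes off \<open>U\<close> and is at most
  \<open>2 * K\<close> on it, so its norm is at most \<open>2 * K\<close> times the capacity of
  \<open>U\<close>.\<close>

lemma quasi_continuous_bounded_in_upper_L1C:
  fixes X :: "'a::metric_space \<Rightarrow> real"
  assumes \<P>: "\<P> \<subseteq> borel_prob_measures" and X: "X \<in> borel_measurable borel"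
    and qc: "quasi_continuous \<P> X" and K: "\<And>\<omega>. \<bar>X \<omega>\<bar> \<le> K"
  shows "X \<in> upper_L1C \<P>"
  unfolding upper_L1C_iff
proof (intro conjI allI impI)
  show "X \<in> upper_L1 \<P>"
    using \<P> X K by (rule bounded_in_upper_L1)
  have K0: "0 \<le> K" using K[of undefined] by linarith
  fix \<epsilon> :: real assume \<epsilon>: "\<epsilon> > 0"
  \<comment> \<open>The summand 1 avoids division by zero for \<open>K = 0\<close> and makes
    \<open>2 * K * \<delta> < \<epsilon>\<close> strict.\<close>
  define \<delta> where "\<delta> = \<epsilon> / (2 * K + 1)"
  have "\<delta> > 0" using \<epsilon> K0 by (simp add: \<delta>_def)
  then obtain U where U: "open U" "upper_capacity \<P> U < ennreal \<delta>" "continuous_on (- U) X"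
    using qc by (auto simp: quasi_continuous_def)
  obtain g where g: "continuous_map euclidean euclideanreal g" "\<And>\<omega>. \<omega> \<in> - U \<Longrightarrow> g \<omega> = X \<omega>"
    "g ` topspace euclidean \<subseteq> {- K..K}"
  proof (rule Tietze_extension_closed_real_interval)
    show "normal_space (euclidean :: 'a topology)"
      by (simp add: metrizable_imp_normal_space metrizable_space_euclidean)
    show "closedin euclidean (- U)" using U(1) by (simp flip: closed_closedin add: closed_Compl)
    show "continuous_map (top_of_set (- U)) euclideanreal X" using U by simp
    show "X ` (- U) \<subseteq> {- K..K}" using K by (auto simp: image_subset_iff abs_le_iff minus_le_iff)
    show "- K \<le> K" using K0 by simp
  qed blast
  have gK: "\<bar>g \<omega>\<bar> \<le> K" for \<omega>
    using g(3) by (auto simp: image_subset_iff abs_le_iff minus_le_iff)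
  have "g \<in> bcontfun"
    using g(1) gK by (intro bcontfun_normI[of _ K]) auto
  moreover have "upper_L1_norm \<P> (\<lambda>\<omega>. X \<omega> - g \<omega>) \<le> ennreal (2 * K) * upper_capacity \<P> U"
  proof (rule upper_L1_norm_le_upper_capacity)
    show "U \<in> sets P" if "P \<in> \<P>" for P
      using that \<P> U by (auto simp: borel_prob_measures_def)
    show "\<bar>X \<omega> - g \<omega>\<bar> \<le> 2 * K * indicator U \<omega>" for \<omega>
      using K[of \<omega>] gK[of \<omega>] g(2)[of \<omega>] by (cases "\<omega> \<in> U") auto
  qed (use K0 in simp)
  moreover have "\<dots> \<le> ennreal (2 * K) * ennreal \<delta>"
    using U by (intro mult_left_mono) auto
  moreover have "\<dots> = ennreal (2 * K * \<delta>)"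
    using K0 by (simp add: ennreal_mult')
  moreover have "2 * K * \<delta> < \<epsilon>"
    using \<epsilon> K0 by (simp add: \<delta>_def field_simps)
  then have "ennreal (2 * K * \<delta>) < ennreal \<epsilon>"
    using \<epsilon> by (intro ennreal_lessI)
  ultimately show "\<exists>\<phi>\<in>bcontfun. upper_L1_norm \<P> (\<lambda>\<omega>. X \<omega> - \<phi> \<omega>) < ennreal \<epsilon>"
    by (metis le_less_trans)
qed

text \<open>Two exceptional open sets, one for \<open>\<tau>\<close> and one for \<open>X\<close>,
  each get half of the tolerance; off their union both functions are continuous.\<close>

lemma quasi_continuous_min_rv:
  assumes \<P>: "\<P> \<subseteq> borel_prob_measures" and nonneg: "\<And>\<omega>. 0 \<le> \<tau> \<omega>"
    and \<tau>: "\<And>\<delta>::real. \<delta> > 0 \<Longrightarrow> \<exists>U. open U \<and> upper_capacity \<P> U \<le> ennreal \<delta> \<and> continuous_on (- U) \<tau>"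
    and qc: "quasi_continuous \<P> X"
  shows "quasi_continuous \<P> (min_rv \<tau> X)"
  unfolding quasi_continuous_def
proof (intro allI impI)
  fix \<epsilon> :: real assume \<epsilon>: "\<epsilon> > 0"
  obtain U where U: "open U" "upper_capacity \<P> U \<le> ennreal (\<epsilon> / 2)" "continuous_on (- U) \<tau>"
    using \<tau>[of "\<epsilon> / 2"] \<epsilon> by auto
  obtain V where V: "open V" "upper_capacity \<P> V < ennreal (\<epsilon> / 2)" "continuous_on (- V) X"
    using qc \<epsilon> half_gt_zero unfolding quasi_continuous_def by blast
  have "upper_capacity \<P> (U \<union> V) \<le> upper_capacity \<P> U + upper_capacity \<P> V"
    using \<P> U V by (intro upper_capacity_Un_le) (auto simp: borel_prob_measures_def)
  also have "\<dots> \<le> ennreal (\<epsilon> / 2) + upper_capacity \<P> V"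
    using U by (intro add_right_mono)
  \<comment> \<open>The bound for \<open>U\<close> is not strict, so strictness has to come from
    \<open>V\<close>; adding a finite value preserves it.\<close>
  also have "\<dots> < ennreal (\<epsilon> / 2) + ennreal (\<epsilon> / 2)"
    using V by (simp add: ennreal_add_left_cancel_less)
  also have "\<dots> = ennreal \<epsilon>"
    using \<epsilon> by (simp flip: ennreal_plus)
  finally have "upper_capacity \<P> (U \<union> V) < ennreal \<epsilon>" .
  moreover have "continuous_on (- (U \<union> V)) (min_rv \<tau> X)"
    using U(3) V(3) nonneg by (intro continuous_on_min_rv) (auto elim: continuous_on_subset)
  ultimately show "\<exists>U. open U \<and> upper_capacity \<P> U < ennreal \<epsilon> \<and> continuous_on (- U) (min_rv \<tau> X)"
    using U V by blast
qed

text \<open>Two approximations: \<open>X\<close> by a bounded continuous \<open>\<phi>\<close>,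
  where truncation does not increase the error, and then the bounded quasi-continuous
  \<open>min_rv \<tau> \<phi>\<close> by a bounded continuous \<open>\<psi>\<close>.\<close>

lemma min_rv_in_upper_L1C:
  fixes \<tau> :: "'a::metric_space \<Rightarrow> ereal"
  assumes \<P>: "\<P> \<subseteq> borel_prob_measures" and nonneg: "\<And>\<omega>. 0 \<le> \<tau> \<omega>"
    and meas: "\<tau> \<in> borel_measurable borel"
    and \<tau>: "\<And>\<delta>::real. \<delta> > 0 \<Longrightarrow> \<exists>U. open U \<and> upper_capacity \<P> U \<le> ennreal \<delta> \<and> continuous_on (- U) \<tau>"
    and X: "X \<in> upper_L1C \<P>"
  shows "min_rv \<tau> X \<in> upper_L1C \<P>"
  unfolding upper_L1C_iff
proof (intro conjI allI impI)
  have XL: "X \<in> upper_L1 \<P>" and Xm: "X \<in> borel_measurable borel"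
    using X by (auto simp: upper_L1C_def upper_L1_def)
  note tm = borel_measurable_min_rv[OF meas]
  show "min_rv \<tau> X \<in> upper_L1 \<P>"
    using XL tm[OF Xm] abs_min_rv_le[of \<tau>, OF nonneg] by (rule upper_L1_mono)
  fix \<epsilon> :: real assume \<epsilon>: "\<epsilon> > 0"
  then have \<epsilon>2: "\<epsilon> / 2 > 0" by simp
  obtain \<phi> where \<phi>: "\<phi> \<in> bcontfun" "upper_L1_norm \<P> (\<lambda>\<omega>. X \<omega> - \<phi> \<omega>) < ennreal (\<epsilon> / 2)"
    using X \<epsilon>2 unfolding upper_L1C_iff by blast
  have \<phi>c: "continuous_on UNIV \<phi>" using \<phi> by (simp add: bcontfun_def)
  then have \<phi>m: "\<phi> \<in> borel_measurable borel" by (rule borel_measurable_continuous_onI)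
  obtain K where K: "\<And>\<omega>. \<bar>\<phi> \<omega>\<bar> \<le> K"
    using \<phi> by (auto simp: bcontfun_def bounded_iff)
  \<comment> \<open>The empty set is the exceptional set for the continuous
    \<open>\<phi>\<close>.\<close>
  have "upper_capacity \<P> {} = 0"
    by (auto simp: upper_capacity_def bot_ennreal intro!: SUP_eq_const antisym SUP_least)
  then have "quasi_continuous \<P> \<phi>"
    using \<phi>c by (auto simp: quasi_continuous_def intro!: exI[of _ "{}"])
  then have "quasi_continuous \<P> (min_rv \<tau> \<phi>)"
    using \<P> nonneg \<tau> by (intro quasi_continuous_min_rv)
  moreover have "\<bar>min_rv \<tau> \<phi> \<omega>\<bar> \<le> K" for \<omega>
    using abs_min_rv_le[of \<tau>, OF nonneg] K by (rule order_trans)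
  ultimately have "min_rv \<tau> \<phi> \<in> upper_L1C \<P>"
    using \<P> tm[OF \<phi>m] by (intro quasi_continuous_bounded_in_upper_L1C)
  then obtain \<psi> where \<psi>: "\<psi> \<in> bcontfun"
    "upper_L1_norm \<P> (\<lambda>\<omega>. min_rv \<tau> \<phi> \<omega> - \<psi> \<omega>) < ennreal (\<epsilon> / 2)"
    using \<epsilon>2 unfolding upper_L1C_iff by blast
  have \<psi>m: "\<psi> \<in> borel_measurable borel"
    using \<psi> by (intro borel_measurable_continuous_onI) (simp add: bcontfun_def)
  \<comment> \<open>The triangle inequality for the norm asks for measurability with respect to each
    \<open>P\<close>, which is Borel measurability.\<close>
  have P: "borel_measurable P = (borel_measurable borel :: ('a \<Rightarrow> real) set)" if "P \<in> \<P>" for P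
    using that \<P> by (intro measurable_cong_sets) (auto simp: borel_prob_measures_def)
  have "upper_L1_norm \<P> (\<lambda>\<omega>. min_rv \<tau> X \<omega> - \<psi> \<omega>)
      = upper_L1_norm \<P> (\<lambda>\<omega>. (min_rv \<tau> X \<omega> - min_rv \<tau> \<phi> \<omega>) + (min_rv \<tau> \<phi> \<omega> - \<psi> \<omega>))"
    by simp
  also have "\<dots> \<le> upper_L1_norm \<P> (\<lambda>\<omega>. min_rv \<tau> X \<omega> - min_rv \<tau> \<phi> \<omega>)
      + upper_L1_norm \<P> (\<lambda>\<omega>. min_rv \<tau> \<phi> \<omega> - \<psi> \<omega>)"
    by (intro upper_L1_norm_add_le) (auto simp: P intro!: borel_measurable_diff tm Xm \<phi>m \<psi>m)
  also have "\<dots> \<le> upper_L1_norm \<P> (\<lambda>\<omega>. X \<omega> - \<phi> \<omega>) + upper_L1_norm \<P> (\<lambda>\<omega>. min_rv \<tau> \<phi> \<omega> - \<psi> \<omega>)"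
    using abs_min_rv_diff_le[of \<tau>, OF nonneg] by (intro add_right_mono upper_L1_norm_mono)
  also have "\<dots> < ennreal (\<epsilon> / 2) + ennreal (\<epsilon> / 2)"
    using \<phi>(2) \<psi>(2) by (rule add_strict_mono)
  also have "\<dots> = ennreal \<epsilon>"
    using \<epsilon> by (simp flip: ennreal_plus)
  finally show "\<exists>\<psi>\<in>bcontfun. upper_L1_norm \<P> (\<lambda>\<omega>. min_rv \<tau> X \<omega> - \<psi> \<omega>) < ennreal \<epsilon>"
    using \<psi>(1) by blast
qed

theorem corollary3p7:
  fixes \<P> :: "((real ^ 'k) path) measure set"
    and Y :: "real \<Rightarrow> (real ^ 'k) path \<Rightarrow> real ^ 'd"
    and Q :: "(real ^ 'd) set"
  assumes "weakly_compact \<P>"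
    and "continuous_semimartingale_family \<P> Y"
    and "open Q"
    and "\<And>\<delta>::real. \<delta> > 0 \<Longrightarrow> \<exists>U. open U \<and> upper_capacity \<P> U \<le> ennreal \<delta> \<and>
           lower_semicontinuous_on (- U) (exit_time Y Q) \<and>
           upper_semicontinuous_on (- U) (exit_time Y (closure Q)) \<and>
           (\<forall>\<omega>\<in>- U. exit_time Y Q \<omega> = exit_time Y (closure Q) \<omega>)"
  shows "(\<forall>X \<in> borel_measurable borel. quasi_continuous \<P> X \<longrightarrow>
            quasi_continuous \<P> (min_rv (exit_time Y Q) X) \<and>
            quasi_continuous \<P> (min_rv (exit_time Y (closure Q)) X)) \<and>
         (\<forall>X \<in> upper_L1C \<P>.
            min_rv (exit_time Y Q) X \<in> upper_L1C \<P> \<and>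
            min_rv (exit_time Y (closure Q)) X \<in> upper_L1C \<P>)"
proof -
  note \<P> = weakly_compact_subset_borel_prob_measures[OF assms(1)]
  have Y: "adapted canonical_filtration Y" "\<And>\<omega>. continuous_on {0..} (\<lambda>t. Y t \<omega>)"
    using assms(2) by (auto simp: continuous_semimartingale_family_def)
  note meas = adapted_canonical_borel_measurable[OF Y(1)]
  \<comment> \<open>Membership in \<open>upper_L1C\<close> includes Borel measurability of the
    truncated function, hence that of the exit times is required.\<close>
  have mQ: "exit_time Y Q \<in> borel_measurable borel"
    using meas Y(2) assms(3) by (rule borel_measurable_exit_time_open)
  have mcQ: "exit_time Y (closure Q) \<in> borel_measurable borel"
    using meas Y(2) closed_closure by (rule borel_measurable_exit_time_closed)
  \<comment> \<open>One \<open>U\<close> serves both exit times: off \<open>U\<close> they agree, so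
    each takes over the semicontinuity assumed for the other.\<close>
  have cont: "\<exists>U. open U \<and> upper_capacity \<P> U \<le> ennreal \<delta> \<and>
      continuous_on (- U) (exit_time Y Q) \<and> continuous_on (- U) (exit_time Y (closure Q))"
    if \<delta>: "\<delta> > 0" for \<delta> :: real
  proof -
    obtain U where U: "open U" "upper_capacity \<P> U \<le> ennreal \<delta>"
      "lower_semicontinuous_on (- U) (exit_time Y Q)"
      "upper_semicontinuous_on (- U) (exit_time Y (closure Q))"
      "\<And>\<omega>. \<omega> \<in> - U \<Longrightarrow> exit_time Y Q \<omega> = exit_time Y (closure Q) \<omega>"
      using assms(4)[OF \<delta>] by blast
    have "upper_semicontinuous_on (- U) (exit_time Y Q)"
      using U(5)[symmetric] U(4) by (rule upper_semicontinuous_on_cong)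
    then have "continuous_on (- U) (exit_time Y Q)"
      using U(3) by (simp add: continuous_on_iff_semicontinuous_on)
    moreover from this have "continuous_on (- U) (exit_time Y (closure Q))"
      using U(5) by (rule continuous_on_eq)
    ultimately show ?thesis using U by blast
  qed
  have cQ: "\<exists>U. open U \<and> upper_capacity \<P> U \<le> ennreal \<delta> \<and> continuous_on (- U) (exit_time Y Q)"
    and ccQ: "\<exists>U. open U \<and> upper_capacity \<P> U \<le> ennreal \<delta> \<and> continuous_on (- U) (exit_time Y (closure Q))"
    if "\<delta> > 0" for \<delta> :: real
    using cont[OF that] by blast+
  show ?thesis
    by (intro conjI ballI impI quasi_continuous_min_rv[OF \<P> exit_time_nonneg]
        min_rv_in_upper_L1C[OF \<P> exit_time_nonneg] mQ mcQ cQ ccQ)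
qed

end
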